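(* Let $q\in(0,1]$, let $\{\alpha_n\}_{n=0}^\infty$ be a bounded sequence of real numbers, and let $T$ be the operator on $A^2(\mathbb{D})$ given by $T(f)=\sum_{n=0}^\infty\alpha_n(n+1)\langle f,z^n\rangle z^n$ for $f\in A^2(\mathbb{D})$. Then the $q$-Berezin range $\mathbf{Ber}_q(T)$ is convex.
   Context: $\mathbb{D}$ is the open unit disk; $A^2(\mathbb{D})$ is the Bergman space of holomorphic $f$ on $\mathbb{D}$ with $\int_{\mathbb{D}}|f|^2dA<\infty$, $dA$ being area measure normalized so that $\mathbb{D}$ has area $1$ (so $\{\sqrt{n+1}\,z^n\}_{n\ge0}$ is an orthonormal basis). Its normalized reproducing kernel is $\hat k_\lambda(z)=\frac{1-|\lambda|^2}{(1-\overline\lambda z)^2}$, $\lambda,z\in\mathbb{D}$. For a bounded operator $T$ on $A^2(\mathbb{D})$, $\mathbf{Ber}_q(T)=\{\langle T\hat k_\lambda,\hat k_\mu\rangle:\lambda,\mu\in\mathbb{D},\ \langle\hat k_\lambda,\hat k_\mu\rangle=q\}$. *)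

theory Defs
  imports "HOL-Analysis.Analysis"
begin

abbreviation unit_disk :: "complex set" where
  "unit_disk \<equiv> ball 0 1"

definition disk_area :: "complex measure" where
  "disk_area = density (lebesgue_on unit_disk) (\<lambda>_. ennreal (1 / pi))"

lemma emeasure_disk_area: "emeasure disk_area unit_disk = 1"
proof -
  have c: "measure lebesgue unit_disk = pi"
    using content_ball[of 1 "0 :: complex"] by (simp add: unit_ball_vol_2)
  have "emeasure lebesgue unit_disk = ennreal pi"
    using c by (metis emeasure_eq_measure2 lmeasurable_ball fmeasurableD2 infinity_ennreal_def)
  then have "emeasure (lebesgue_on unit_disk) unit_disk = ennreal pi"
    by (simp add: emeasure_restrict_space)
  moreover have "unit_disk \<in> sets (lebesgue_on unit_disk)"
    by (simp add: sets_restrict_space_iff)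
  ultimately show ?thesis
    unfolding disk_area_def
    by (subst emeasure_density) (auto simp: nn_integral_cmult_indicator simp flip: ennreal_mult)
qed

text \<open>
  A function on the disk is represented by a total function on the complex plane. Its values
  outside the disk are arbitrary, and they affect neither membership in the space nor the
  inner product.
\<close>

definition bergman_space :: "(complex \<Rightarrow> complex) set" where
  "bergman_space =
     {f. f holomorphic_on unit_disk \<and> integrable disk_area (\<lambda>z. (cmod (f z))\<^sup>2)}"

definition bergman_inner :: "(complex \<Rightarrow> complex) \<Rightarrow> (complex \<Rightarrow> complex) \<Rightarrow> complex" where
  "bergman_inner f g = (LINT z|disk_area. f z * cnj (g z))"

definition bergman_norm :: "(complex \<Rightarrow> complex) \<Rightarrow> real" where
  "bergman_norm f = sqrt (LINT z|disk_area. (cmod (f z))\<^sup>2)"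

definition bergman_sums :: "(nat \<Rightarrow> complex \<Rightarrow> complex) \<Rightarrow> (complex \<Rightarrow> complex) \<Rightarrow> bool" where
  "bergman_sums g h \<longleftrightarrow>
     h \<in> bergman_space \<and> (\<forall>n. g n \<in> bergman_space) \<and>
     (\<lambda>N. bergman_norm (\<lambda>z. (\<Sum>n<N. g n z) - h z)) \<longlonglongrightarrow> 0"

text \<open>The normalized reproducing kernel at \<open>a\<close>.\<close>

definition bergman_kernel :: "complex \<Rightarrow> complex \<Rightarrow> complex" where
  "bergman_kernel a z = (1 - (cmod a)\<^sup>2) / (1 - cnj a * z)\<^sup>2"

definition q_berezin_range ::
    "complex \<Rightarrow> ((complex \<Rightarrow> complex) \<Rightarrow> (complex \<Rightarrow> complex)) \<Rightarrow> complex set" where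
  "q_berezin_range q T =
     {bergman_inner (T (bergman_kernel a)) (bergman_kernel b) | a b.
        a \<in> unit_disk \<and> b \<in> unit_disk \<and>
        bergman_inner (bergman_kernel a) (bergman_kernel b) = q}"

end

theory Submission
  imports Defs
begin

text \<open>
  Writing \<open>w = cnj a * b\<close>, the reproducing kernels satisfy
  \<open>\<langle>k a, k b\<rangle> = (1 - (cmod a)\<^sup>2) * (1 - (cmod b)\<^sup>2) / (1 - w)\<^sup>2\<close>. If this equals \<open>q > 0\<close>, then
  \<open>1 - w\<close> has a positive square and a positive real part, so \<open>w\<close> is real, and
  \<open>\<langle>T (k a), k b\<rangle> = q * (1 - w)\<^sup>2 * (\<Sum>n. \<alpha> n * (n + 1) * w ^ n)\<close> is a continuous real function of \<open>w\<close>
  alone. By AM-GM the values of \<open>w\<close> that occur form an interval, so the range is an interval of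
  the real line.
\<close>

section \<open>Rotation invariance of Lebesgue measure on the plane\<close>

text \<open>As in the proof that Haar measure is unique, multiplying by the measure of a ball and applying
  Fubini's theorem reduces this to translation invariance and the rotation invariance of the ball.\<close>

lemma lborel_distr_rotation:
  fixes u :: complex
  assumes u: "cmod u = 1"
  shows "distr lborel borel ((*) u) = lborel"
proof (rule measure_eqI)
  fix A assume "A \<in> sets (distr lborel borel ((*) u))"
  then have A [measurable]: "A \<in> sets borel" by simp
  define f g :: "complex \<Rightarrow> ennreal" where "f = indicator A" and "g = indicator (ball 0 1)"
  have [measurable]: "f \<in> borel_measurable borel" "g \<in> borel_measurable borel"
    by (auto simp: f_def g_def intro!: borel_measurable_indicator)
  have uu: "u * cnj u = 1" "cnj u * u = 1"
    using u by (simp_all add: complex_norm_square[symmetric] mult.commute[of "cnj u"])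
  have transl: "(\<integral>\<^sup>+x. h (c + x) \<partial>lborel) = (\<integral>\<^sup>+x. h x \<partial>lborel)"
    if [measurable]: "h \<in> borel_measurable borel" for h :: "complex \<Rightarrow> ennreal" and c
  proof -
    have "(\<integral>\<^sup>+x. h x \<partial>lborel) = (\<integral>\<^sup>+x. h x \<partial>distr lborel borel ((+) c))"
      by (simp add: lborel_distr_plus)
    then show ?thesis by (simp add: nn_integral_distr)
  qed
  have fubini: "(\<integral>\<^sup>+y. \<integral>\<^sup>+x. h x y \<partial>lborel \<partial>lborel) = (\<integral>\<^sup>+x. \<integral>\<^sup>+y. h x y \<partial>lborel \<partial>lborel)"
    if "(\<lambda>(x, y). h x y) \<in> borel_measurable (borel \<Otimes>\<^sub>M borel)"
    for h :: "complex \<Rightarrow> complex \<Rightarrow> ennreal"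
    using that by (intro lborel_pair.Fubini') simp
  \<comment> \<open>The two arguments differ by the factor \<open>- u\<close> of modulus 1, and the
    unit ball is invariant under multiplication by it.\<close>
  have symm: "g (- (u * x) + y) = g (- (cnj u * y) + x)" for x y
  proof -
    have "- (u * x) + y = - u * (- (cnj u * y) + x)"
      using uu by (simp add: algebra_simps)
    then have "cmod (- (u * x) + y) = cmod (- (cnj u * y) + x)"
      by (simp only: norm_mult norm_minus_cancel u mult_1)
    then show ?thesis
      by (simp add: g_def indicator_def)
  qed
  have "(\<integral>\<^sup>+x. f (u * x) \<partial>lborel) * (\<integral>\<^sup>+y. g y \<partial>lborel)
      = (\<integral>\<^sup>+y. (\<integral>\<^sup>+x. f (u * x) * g y \<partial>lborel) \<partial>lborel)"
    by (simp add: nn_integral_cmult nn_integral_multc)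
  \<comment> \<open>Since \<open>u * cnj u = 1\<close>, shifting \<open>x\<close> by
    \<open>cnj u * y\<close> shifts the argument of \<open>f\<close> by \<open>y\<close>.\<close>
  also have "\<dots> = (\<integral>\<^sup>+y. (\<integral>\<^sup>+x. f (u * (cnj u * y + x)) * g y \<partial>lborel) \<partial>lborel)"
    by (intro nn_integral_cong transl[symmetric]) simp
  also have "\<dots> = (\<integral>\<^sup>+y. (\<integral>\<^sup>+x. f (u * x + y) * g y \<partial>lborel) \<partial>lborel)"
  proof -
    have "u * (cnj u * y + x) = u * x + y" for x y
      by (simp add: distrib_left mult.assoc[symmetric] uu add.commute)
    then show ?thesis by simp
  qed
  also have "\<dots> = (\<integral>\<^sup>+x. (\<integral>\<^sup>+y. f (u * x + y) * g y \<partial>lborel) \<partial>lborel)"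
    by (rule fubini) measurable
  \<comment> \<open>Shifting \<open>y\<close> by \<open>- (u * x)\<close> removes \<open>x\<close>
    from \<open>f\<close> and moves it into \<open>g\<close>, where \<open>symm\<close> turns it
    into a term that one more translation absorbs.\<close>
  also have "\<dots> = (\<integral>\<^sup>+x. (\<integral>\<^sup>+y. f (u * x + (- (u * x) + y)) * g (- (u * x) + y) \<partial>lborel) \<partial>lborel)"
    by (intro nn_integral_cong transl[symmetric]) simp
  also have "\<dots> = (\<integral>\<^sup>+x. (\<integral>\<^sup>+y. f y * g (- (cnj u * y) + x) \<partial>lborel) \<partial>lborel)"
    unfolding symm by simp
  also have "\<dots> = (\<integral>\<^sup>+y. (\<integral>\<^sup>+x. f y * g (- (cnj u * y) + x) \<partial>lborel) \<partial>lborel)"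
    by (rule fubini[symmetric]) measurable
  also have "\<dots> = (\<integral>\<^sup>+y. (\<integral>\<^sup>+x. f y * g x \<partial>lborel) \<partial>lborel)"
    by (intro nn_integral_cong transl) simp
  also have "\<dots> = (\<integral>\<^sup>+y. f y \<partial>lborel) * (\<integral>\<^sup>+x. g x \<partial>lborel)"
    by (simp add: nn_integral_cmult nn_integral_multc)
  finally have "(\<integral>\<^sup>+x. f (u * x) \<partial>lborel) * emeasure lborel (ball (0::complex) 1)
      = (\<integral>\<^sup>+y. f y \<partial>lborel) * emeasure lborel (ball (0::complex) 1)"
    by (simp add: g_def)
  \<comment> \<open>The ball has finite nonzero measure, so the common factor can be
    cancelled.\<close>
  moreover have "emeasure lborel (ball (0::complex) 1) = ennreal pi"
    by (simp add: emeasure_ball unit_ball_vol_2)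
  ultimately have eq: "(\<integral>\<^sup>+x. f (u * x) \<partial>lborel) = (\<integral>\<^sup>+y. f y \<partial>lborel)"
    by (simp add: mult.commute[of _ "ennreal pi"] ennreal_mult_cancel_left)
  have "emeasure (distr lborel borel ((*) u)) A = (\<integral>\<^sup>+x. f x \<partial>distr lborel borel ((*) u))"
    by (simp add: f_def)
  also have "\<dots> = emeasure lborel A"
    by (subst nn_integral_distr) (simp_all add: eq, simp add: f_def)
  finally show "emeasure (distr lborel borel ((*) u)) A = emeasure lborel A" .
qed simp

section \<open>Normalized area measure on the disk\<close>

lemma space_disk_area [simp]: "space disk_area = unit_disk"
  by (simp add: disk_area_def space_restrict_space)

lemma sets_disk_area [measurable_cong]: "sets disk_area = sets (lebesgue_on unit_disk)"
  by (simp add: disk_area_def)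

interpretation disk: finite_measure disk_area
  by standard (simp add: emeasure_disk_area)

lemma borel_measurable_disk_area_continuous:
  "continuous_on unit_disk f \<Longrightarrow> f \<in> borel_measurable disk_area"
  unfolding disk_area_def
  by (simp add: continuous_imp_measurable_on_sets_lebesgue)

lemma borel_measurable_disk_area:
  assumes [measurable]: "f \<in> borel_measurable borel"
  shows "f \<in> borel_measurable disk_area"
proof -
  have "f \<in> borel_measurable lebesgue"
    using assms by (simp add: measurable_completion)
  then show ?thesis
    unfolding disk_area_def by (simp add: measurable_restrict_space1)
qed

text \<open>Moves integrals to \<open>lborel\<close>, where \<open>lborel_distr_rotation\<close>
  applies; Borel measurability of \<open>f\<close> allows the completion to be dropped.\<close>

lemma integral_disk_area:
  fixes f :: "complex \<Rightarrow> 'b::{banach, second_countable_topology}"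
  assumes [measurable]: "f \<in> borel_measurable borel"
  shows "(LINT z|disk_area. f z) = (LINT z|lborel. (indicator unit_disk z / pi) *\<^sub>R f z)"
proof -
  have m: "f \<in> borel_measurable lebesgue"
    by (simp add: measurable_completion)
  have [measurable]: "(indicator unit_disk :: complex \<Rightarrow> real) \<in> borel_measurable borel"
    by (simp add: borel_measurable_indicator)
  have "(LINT z|disk_area. f z) = (LINT z|lebesgue_on unit_disk. (1 / pi) *\<^sub>R f z)"
    unfolding disk_area_def using m
    by (subst integral_density) (auto simp: measurable_restrict_space1)
  also have "\<dots> = (LINT z|lebesgue. (indicator unit_disk z / pi) *\<^sub>R f z)"
    by (subst integral_restrict_space) simp_all
  also have "\<dots> = (LINT z|lborel. (indicator unit_disk z / pi) *\<^sub>R f z)"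
    by (rule integral_completion) simp
  finally show ?thesis .
qed

text \<open>A rotation preserves both \<open>lborel\<close> and the indicator of the disk.\<close>

lemma integral_disk_area_rotation:
  fixes f :: "complex \<Rightarrow> 'b::{banach, second_countable_topology}"
  assumes [measurable]: "f \<in> borel_measurable borel" and u: "cmod u = 1"
  shows "(LINT z|disk_area. f (u * z)) = (LINT z|disk_area. f z)"
proof -
  have [measurable]: "(indicator unit_disk :: complex \<Rightarrow> real) \<in> borel_measurable borel"
    by (simp add: borel_measurable_indicator)
  have "(LINT z|disk_area. f z)
      = (LINT z|distr lborel borel ((*) u). (indicator unit_disk z / pi) *\<^sub>R f z)"
    using u by (simp add: integral_disk_area lborel_distr_rotation)
  also have "\<dots> = (LINT z|lborel. (indicator unit_disk (u * z) / pi) *\<^sub>R f (u * z))"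
    by (subst integral_distr) simp_all
  also have "\<dots> = (LINT z|disk_area. f (u * z))"
    by (subst integral_disk_area) (simp_all add: indicator_def norm_mult u)
  finally show ?thesis ..
qed

lemma emeasure_disk_area_borel:
  assumes [measurable]: "A \<in> sets borel" and "A \<subseteq> unit_disk"
  shows "emeasure disk_area A = ennreal (1 / pi) * emeasure lborel A"
proof -
  have L: "A \<in> sets lebesgue" by simp
  have "emeasure disk_area A = ennreal (1 / pi) * emeasure (lebesgue_on unit_disk) A"
    unfolding disk_area_def using assms(2) L
    by (subst emeasure_density)
       (auto simp: sets_restrict_space_iff nn_integral_cmult_indicator)
  then show ?thesis
    using assms(2) by (simp add: emeasure_restrict_space)
qed

text \<open>A substitute for polar coordinates: for \<open>0 \<le> x < 1\<close> the annulus
  \<open>sqrt x < cmod z < 1\<close> has normalized area \<open>1 - x\<close>, so the squared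
  modulus is uniformly distributed on the unit interval. The two measures are compared on the
  half-lines \<open>{x<..}\<close>, which determine them.\<close>

lemma distr_disk_area_norm_square:
  "distr disk_area borel (\<lambda>z. (cmod z)\<^sup>2) = density lborel (indicator {0..1::real})"
proof (rule measure_eqI_lessThan)
  have m [measurable]: "(\<lambda>z. (cmod z)\<^sup>2) \<in> borel_measurable disk_area"
    by (intro borel_measurable_disk_area) simp
  fix x :: real
  have l: "emeasure (distr disk_area borel (\<lambda>z. (cmod z)\<^sup>2)) {x<..}
      = emeasure disk_area {z\<in>unit_disk. x < (cmod z)\<^sup>2}"
    by (subst emeasure_distr) (auto intro!: arg_cong[where f = "emeasure disk_area"])
  show "emeasure (distr disk_area borel (\<lambda>z. (cmod z)\<^sup>2)) {x<..} < \<infinity>"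
    unfolding l by (simp add: disk.emeasure_finite less_top[symmetric])
  have r: "emeasure (density lborel (indicator {0..1::real})) {x<..} = emeasure lborel ({0..1} \<inter> {x<..})"
    by (subst emeasure_density) (simp_all flip: indicator_inter_arith)
  show "emeasure (distr disk_area borel (\<lambda>z. (cmod z)\<^sup>2)) {x<..}
      = emeasure (density lborel (indicator {0..1::real})) {x<..}"
  proof -
    consider "x < 0" | "0 \<le> x" "x < 1" | "1 \<le> x" by linarith
    then show ?thesis
    proof cases
      case 1
      then have "{z\<in>unit_disk. x < (cmod z)\<^sup>2} = unit_disk" "{0..1} \<inter> {x<..} = {0..1}"
        by (auto intro: less_le_trans)
      then show ?thesis unfolding l r by (simp add: emeasure_disk_area)
    next
      case 2
      have sqrt1: "sqrt x < 1" using 2 by simp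
      have "{z\<in>unit_disk. x < (cmod z)\<^sup>2} = unit_disk - cball 0 (sqrt x)"
      proof -
        have "x < (cmod z)\<^sup>2 \<longleftrightarrow> \<not> cmod z \<le> sqrt x" for z
          using 2 by (metis norm_ge_zero abs_norm_cancel not_le real_sqrt_abs real_sqrt_less_iff)
        then show ?thesis
          by (intro set_eqI) (simp only: mem_Collect_eq Diff_iff mem_cball_0)
      qed
      moreover have "cball 0 (sqrt x) \<subseteq> (unit_disk :: complex set)"
        by (intro subsetI) (simp only: mem_cball_0 mem_ball_0 le_less_trans[OF _ sqrt1])
      then have "emeasure lborel (unit_disk - cball 0 (sqrt x)) = ennreal pi - ennreal (pi * x)"
        using 2 by (subst emeasure_Diff) (auto simp: emeasure_ball emeasure_cball unit_ball_vol_2)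
      moreover have "{0..1} \<inter> {x<..} = {x<..1}" using 2 by auto
      ultimately show ?thesis unfolding l r using 2
        by (simp add: emeasure_disk_area_borel ennreal_minus ennreal_mult[symmetric]
            diff_divide_distrib)
    next
      case 3
      have "(cmod z)\<^sup>2 \<le> x" if "z \<in> unit_disk" for z
        using that 3 power_le_one[of "cmod z" 2] by simp
      then have "{z\<in>unit_disk. x < (cmod z)\<^sup>2} = {}"
        by (auto simp: not_less[symmetric])
      moreover have "{0..1} \<inter> {x<..} = {}" using 3 by auto
      ultimately show ?thesis unfolding l r by (simp only: emeasure_empty)
    qed
  qed
qed simp_all

section \<open>Orthogonality of the monomials\<close>

text \<open>For \<open>n = m\<close> the integral is the \<open>n\<close>-th moment of the uniform
  distribution on the unit interval. For \<open>n \<noteq> m\<close> a suitable rotation changes the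
  sign of the integrand, so the integral equals its own negative.\<close>

lemma bergman_inner_monomials:
  "bergman_inner (\<lambda>z. z ^ n) (\<lambda>z. z ^ m) = (if n = m then 1 / (of_nat n + 1) else 0)"
proof (cases "n = m")
  case True
  have m [measurable]: "(\<lambda>z. (cmod z)\<^sup>2) \<in> borel_measurable disk_area"
    by (intro borel_measurable_disk_area) simp
  have "bergman_inner (\<lambda>z. z ^ n) (\<lambda>z. z ^ n) = (LINT z|disk_area. complex_of_real (((cmod z)\<^sup>2) ^ n))"
    unfolding bergman_inner_def of_real_power[of _ n] complex_norm_square
    by (simp add: power_mult_distrib)
  also have "\<dots> = of_real (LINT x|distr disk_area borel (\<lambda>z. (cmod z)\<^sup>2). x ^ n)"
    by (subst integral_distr) (simp_all del: of_real_power)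
  also have "(LINT x|distr disk_area borel (\<lambda>z. (cmod z)\<^sup>2). x ^ n)
      = (LINT x|density lborel (\<lambda>x. ennreal (indicator {0..1::real} x)). x ^ n)"
    by (simp add: distr_disk_area_norm_square ennreal_indicator)
  also have "\<dots> = (LINT x|lborel. x ^ n * indicator {0..1} x)"
    by (subst integral_density) (auto simp: mult.commute)
  also have "\<dots> = 1 / (real n + 1)"
    by (simp add: integral_power add.commute)
  finally show ?thesis
    using True by simp
next
  case False
  \<comment> \<open>Chosen so that \<open>(n - m) * t = pi\<close>: rotation by the angle
    \<open>t\<close> multiplies \<open>z ^ n * cnj (z ^ m)\<close> by
    \<open>cis pi = -1\<close>.\<close>
  define t where "t = pi / (real n - real m)"
  have "(real n - real m) * t = pi"
    using False by (simp add: t_def)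
  then have t: "real n * t - real m * t = pi"
    by (simp add: left_diff_distrib)
  have "continuous_on UNIV (\<lambda>z. z ^ n * cnj (z ^ m))"
    by (intro continuous_intros)
  then have m: "(\<lambda>z. z ^ n * cnj (z ^ m)) \<in> borel_measurable borel"
    by (rule borel_measurable_continuous_onI)
  define I where "I = bergman_inner (\<lambda>z. z ^ n) (\<lambda>z. z ^ m)"
  have c: "cis t ^ n * cnj (cis t) ^ m = -1"
    using t by (simp add: Complex.DeMoivre cis_cnj cis_mult)
  have "I = (LINT z|disk_area. (cis t * z) ^ n * cnj ((cis t * z) ^ m))"
    unfolding I_def bergman_inner_def 
    using m by (intro integral_disk_area_rotation[symmetric]) simp_all
  also have "\<dots> = (LINT z|disk_area. (cis t ^ n * cnj (cis t) ^ m) * (z ^ n * cnj (z ^ m)))"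
    by (simp add: power_mult_distrib mult_ac)
  also have "\<dots> = - I"
    unfolding c by (simp add: I_def bergman_inner_def)
  finally have "I = 0" by simp
  then show ?thesis using False by (simp add: I_def)
qed

section \<open>Membership in the Bergman space and continuity of its inner product\<close>

lemma bergman_space_measurable:
  "f \<in> bergman_space \<Longrightarrow> f \<in> borel_measurable disk_area"
  unfolding bergman_space_def
  by (auto intro: borel_measurable_disk_area_continuous holomorphic_on_imp_continuous_on)

lemma bounded_holomorphic_bergman_space:
  assumes "f holomorphic_on unit_disk" and "\<And>z. z \<in> unit_disk \<Longrightarrow> cmod (f z) \<le> B"
  shows "f \<in> bergman_space"
proof -
  have [measurable]: "f \<in> borel_measurable disk_area"
    using assms(1) by (intro borel_measurable_disk_area_continuous holomorphic_on_imp_continuous_on)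
  have "AE z in disk_area. norm ((cmod (f z))\<^sup>2) \<le> B\<^sup>2"
    using assms(2) by (intro AE_I2) (simp add: power_mono)
  then have "integrable disk_area (\<lambda>z. (cmod (f z))\<^sup>2)"
    by (rule disk.integrable_const_bound) measurable
  then show ?thesis using assms(1) by (simp add: bergman_space_def)
qed

lemma bergman_space_diff:
  assumes f: "f \<in> bergman_space" and g: "g \<in> bergman_space"
  shows "(\<lambda>z. f z - g z) \<in> bergman_space"
proof -
  note [measurable] = bergman_space_measurable[OF f] bergman_space_measurable[OF g]
  have "integrable disk_area (\<lambda>z. 2 * (cmod (f z))\<^sup>2 + 2 * (cmod (g z))\<^sup>2)"
    using f g by (simp add: bergman_space_def)
  then have "integrable disk_area (\<lambda>z. (cmod (f z - g z))\<^sup>2)"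
  proof (rule Bochner_Integration.integrable_bound)
    have "(cmod (f z - g z))\<^sup>2 \<le> 2 * (cmod (f z))\<^sup>2 + 2 * (cmod (g z))\<^sup>2" for z
    proof -
      have "(cmod (f z - g z))\<^sup>2 \<le> (cmod (f z) + cmod (g z))\<^sup>2"
        by (intro power_mono norm_triangle_ineq4) simp
      also have "\<dots> \<le> 2 * (cmod (f z))\<^sup>2 + 2 * (cmod (g z))\<^sup>2"
        using sum_squares_bound[of "cmod (f z)" "cmod (g z)"] by (simp add: power2_sum)
      finally show ?thesis .
    qed
    then show "AE z in disk_area. norm ((cmod (f z - g z))\<^sup>2)
        \<le> norm (2 * (cmod (f z))\<^sup>2 + 2 * (cmod (g z))\<^sup>2)"
      by (intro AE_I2) simp
  qed measurable
  then show ?thesis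
    using f g by (auto simp: bergman_space_def intro: holomorphic_on_diff)
qed

lemma bergman_space_sum:
  fixes g :: "nat \<Rightarrow> complex \<Rightarrow> complex"
  assumes "\<And>n. g n \<in> bergman_space"
  shows "(\<lambda>z. \<Sum>n<N. g n z) \<in> bergman_space"
proof (induction N)
  case 0
  then show ?case by (simp add: bergman_space_def)
next
  case (Suc N)
  \<comment> \<open>Adding \<open>g N\<close> is subtracting \<open>0 - g N\<close>, so closure
    under differences suffices.\<close>
  have "(\<lambda>z. 0 - g N z) \<in> bergman_space"
    by (rule bergman_space_diff[OF _ assms]) (simp add: bergman_space_def)
  from bergman_space_diff[OF Suc.IH this] show ?case by simp
qed

text \<open>A special case of Cauchy-Schwarz: as \<open>k\<close> is bounded and
  \<open>disk_area\<close> has total mass 1, it reduces to bounding the L1 norm of \<open>f\<close>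
  by its L2 norm.\<close>

lemma
  assumes f: "f \<in> bergman_space" and k [measurable]: "k \<in> borel_measurable disk_area"
    and B: "\<And>z. z \<in> unit_disk \<Longrightarrow> cmod (k z) \<le> B"
  shows integrable_bergman_mult: "integrable disk_area (\<lambda>z. f z * cnj (k z))"
    and norm_bergman_inner_le: "cmod (bergman_inner f k) \<le> B * bergman_norm f"
proof -
  note [measurable] = bergman_space_measurable[OF f]
  have sq: "integrable disk_area (\<lambda>z. (cmod (f z))\<^sup>2)"
    using f by (simp add: bergman_space_def)
  have int: "integrable disk_area (\<lambda>z. cmod (f z))"
    by (rule disk.square_integrable_imp_integrable) (use sq in simp_all)
  have [measurable]: "(\<lambda>z. cnj (k z)) \<in> borel_measurable disk_area"
    by (rule measurable_compose[OF k]) (intro borel_measurable_continuous_onI continuous_intros)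
  have "0 \<le> B" using B[of 0] norm_ge_zero[of "k 0"] by (simp del: norm_ge_zero)
  have le: "cmod (f z * cnj (k z)) \<le> B * cmod (f z)" if "z \<in> unit_disk" for z
    using mult_right_mono[OF B[OF that] norm_ge_zero[of "f z"]] by (simp add: norm_mult mult.commute)
  show int2: "integrable disk_area (\<lambda>z. f z * cnj (k z))"
  proof (rule Bochner_Integration.integrable_bound)
    show "integrable disk_area (\<lambda>z. B * cmod (f z))" using int by simp
    show "AE z in disk_area. cmod (f z * cnj (k z)) \<le> norm (B * cmod (f z))"
      using le \<open>0 \<le> B\<close> by (intro AE_I2) (simp add: abs_mult)
  qed measurable
  \<comment> \<open>\<open>c\<close> is the mean of \<open>cmod (f z)\<close>; its variance is
    nonnegative, which gives \<open>c\<^sup>2 \<le> (bergman_norm f)\<^sup>2\<close>.\<close>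
  define c where "c = (LINT z|disk_area. cmod (f z))"
  have "0 \<le> (LINT z|disk_area. (cmod (f z) - c)\<^sup>2)" by simp
  also have "\<dots> = (LINT z|disk_area. (cmod (f z))\<^sup>2 - 2 * c * cmod (f z) + c\<^sup>2)"
    by (intro arg_cong[where f = "integral\<^sup>L disk_area"]) (simp add: power2_diff algebra_simps)
  also have "\<dots> = (LINT z|disk_area. (cmod (f z))\<^sup>2) - c\<^sup>2"
    using sq int by (simp add: measure_def emeasure_disk_area power2_eq_square c_def[symmetric])
  finally have "c \<le> bergman_norm f"
    unfolding bergman_norm_def by (intro real_le_rsqrt) simp
  have "cmod (bergman_inner f k) \<le> (LINT z|disk_area. cmod (f z * cnj (k z)))"
    unfolding bergman_inner_def by (rule integral_norm_bound)
  also have "\<dots> \<le> (LINT z|disk_area. B * cmod (f z))"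
    using int int2 le by (intro integral_mono) auto
  also have "\<dots> \<le> B * bergman_norm f"
    using \<open>c \<le> bergman_norm f\<close> \<open>0 \<le> B\<close> by (simp add: c_def mult_left_mono)
  finally show "cmod (bergman_inner f k) \<le> B * bergman_norm f" .
qed

text \<open>Norm convergence implies convergence of inner products with a bounded \<open>k\<close>,
  because the error is at most \<open>B\<close> times the norm of the remainder. This lets the
  series for \<open>T f\<close> be paired with a kernel term by term.\<close>

lemma bergman_sums_inner:
  assumes gh: "bergman_sums g h" and k [measurable]: "k \<in> borel_measurable disk_area"
    and B: "\<And>z. z \<in> unit_disk \<Longrightarrow> cmod (k z) \<le> B"
  shows "(\<lambda>n. bergman_inner (g n) k) sums bergman_inner h k"
proof -
  have h: "h \<in> bergman_space" and g: "\<And>n. g n \<in> bergman_space"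
    and lim: "(\<lambda>N. bergman_norm (\<lambda>z. (\<Sum>n<N. g n z) - h z)) \<longlonglongrightarrow> 0"
    using gh by (auto simp: bergman_sums_def)
  have eq: "(\<Sum>n<N. bergman_inner (g n) k) - bergman_inner h k
      = bergman_inner (\<lambda>z. (\<Sum>n<N. g n z) - h z) k" for N
  proof -
    note int = integrable_bergman_mult[OF _ k B]
    have "bergman_inner (\<lambda>z. (\<Sum>n<N. g n z) - h z) k
        = (LINT z|disk_area. (\<Sum>n<N. g n z * cnj (k z)) - h z * cnj (k z))"
      by (simp add: bergman_inner_def left_diff_distrib sum_distrib_right)
    also have "\<dots> = (\<Sum>n<N. bergman_inner (g n) k) - bergman_inner h k"
      unfolding bergman_inner_def using int[OF g] int[OF h]
      by (subst Bochner_Integration.integral_diff) (auto simp: Bochner_Integration.integral_sum)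
    finally show ?thesis ..
  qed
  have "(\<lambda>N. (\<Sum>n<N. bergman_inner (g n) k) - bergman_inner h k) \<longlonglongrightarrow> 0"
  proof (rule Lim_null_comparison)
    show "\<forall>\<^sub>F N in sequentially. norm ((\<Sum>n<N. bergman_inner (g n) k) - bergman_inner h k)
        \<le> B * bergman_norm (\<lambda>z. (\<Sum>n<N. g n z) - h z)"
      unfolding eq
      by (intro always_eventually allI norm_bergman_inner_le bergman_space_diff bergman_space_sum g h k B)
    show "(\<lambda>N. B * bergman_norm (\<lambda>z. (\<Sum>n<N. g n z) - h z)) \<longlonglongrightarrow> 0"
      using lim by (rule tendsto_mult_right_zero)
  qed
  then show ?thesis
    unfolding sums_def by (rule LIM_zero_cancel)
qed

section \<open>Inner products with the normalized kernels\<close>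

lemma norm_cnj_mult_less_1: "a \<in> unit_disk \<Longrightarrow> z \<in> unit_disk \<Longrightarrow> cmod (cnj a * z) < 1"
  using mult_strict_mono'[of "cmod a" 1 "cmod z" 1] by (simp add: norm_mult)

lemma bergman_kernel_holomorphic:
  assumes "a \<in> unit_disk"
  shows "bergman_kernel a holomorphic_on unit_disk"
proof -
  have "1 - cnj a * z \<noteq> 0" if "z \<in> unit_disk" for z
    using norm_cnj_mult_less_1[OF assms that] by auto
  then show ?thesis
    unfolding bergman_kernel_def[abs_def] by (intro holomorphic_intros) auto
qed

lemma bergman_kernel_measurable:
  "a \<in> unit_disk \<Longrightarrow> bergman_kernel a \<in> borel_measurable disk_area"
  by (intro borel_measurable_disk_area_continuous holomorphic_on_imp_continuous_on
      bergman_kernel_holomorphic)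

lemma norm_one_minus_square_le:
  assumes "a \<in> unit_disk"
  shows "cmod (1 - (complex_of_real (cmod a))\<^sup>2) \<le> 1"
proof -
  have "cmod (complex_of_real (1 - (cmod a)\<^sup>2)) \<le> 1"
    using assms unfolding norm_of_real by (simp add: abs_le_iff power_le_one)
  then show ?thesis by simp
qed

text \<open>The reverse triangle inequality gives
  \<open>cmod (1 - cnj a * z) \<ge> 1 - cmod a\<close>. The bound is uniform in \<open>z\<close>, so
  a kernel may serve as the bounded function \<open>k\<close> in
  \<open>bergman_sums_inner\<close>.\<close>

lemma norm_bergman_kernel_le:
  assumes a: "a \<in> unit_disk" and z: "z \<in> unit_disk"
  shows "cmod (bergman_kernel a z) \<le> 1 / (1 - cmod a)\<^sup>2"
proof -
  have "1 - cmod a \<le> 1 - cmod (cnj a * z)"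
    using z by (simp add: norm_mult mult_left_le)
  also have "\<dots> \<le> cmod (1 - cnj a * z)"
    using norm_triangle_ineq2[of 1 "cnj a * z"] by simp
  finally have "(1 - cmod a)\<^sup>2 \<le> (cmod (1 - cnj a * z))\<^sup>2"
    using a by (intro power_mono) auto
  moreover note norm_one_minus_square_le[OF a]
  ultimately show ?thesis
    using a unfolding bergman_kernel_def
    by (simp add: norm_divide norm_power frac_le)
qed

lemma bergman_kernel_in_space: "a \<in> unit_disk \<Longrightarrow> bergman_kernel a \<in> bergman_space"
  by (rule bounded_holomorphic_bergman_space[OF bergman_kernel_holomorphic norm_bergman_kernel_le])

lemma bergman_inner_cnj: "bergman_inner g f = cnj (bergman_inner f g)"
  using Bochner_Integration.integral_cnj[of disk_area "\<lambda>z. f z * cnj (g z)"]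
  by (simp add: bergman_inner_def mult.commute del: Bochner_Integration.integral_cnj)

lemma summable_linear_power:
  fixes x :: real
  assumes "\<bar>x\<bar> < 1"
  shows "summable (\<lambda>n. (real n + 1) * x ^ n)"
  using sums_summable[OF geometric_deriv_sums[of x]] assms by (simp add: add.commute)

text \<open>The kernel series converges absolutely and uniformly on the disk, so it may be integrated
  term by term.\<close>

lemma bergman_inner_kernel_sums:
  assumes f [measurable]: "f \<in> borel_measurable disk_area"
    and B: "\<And>z. z \<in> unit_disk \<Longrightarrow> cmod (f z) \<le> B" and b: "b \<in> unit_disk"
  shows "(\<lambda>m. (1 - (cmod b)\<^sup>2) * ((of_nat m + 1) * b ^ m * bergman_inner f (\<lambda>z. z ^ m)))
    sums bergman_inner f (bergman_kernel b)"
proof -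
  \<comment> \<open>\<open>h m z\<close> is \<open>f z\<close> times the conjugate of the
    \<open>m\<close>-th Taylor term of \<open>bergman_kernel b\<close> at \<open>z\<close>.\<close>
  define h where "h m z = (1 - (cmod b)\<^sup>2) * ((of_nat m + 1) * b ^ m * (f z * cnj (z ^ m)))" for m z
  have b1: "cmod b < 1" using b by simp
  have [measurable]: "(\<lambda>z. cnj (z ^ m)) \<in> borel_measurable disk_area" for m
    by (intro borel_measurable_disk_area_continuous continuous_intros)
  have hm [measurable]: "h m \<in> borel_measurable disk_area" for m
    unfolding h_def[abs_def] by measurable
  \<comment> \<open>A summable majorant that does not depend on \<open>z\<close>; writing
    \<open>\<bar>B\<bar>\<close> makes its nonnegativity evident.\<close>
  have hb: "cmod (h m z) \<le> \<bar>B\<bar> * ((real m + 1) * cmod b ^ m)" if z: "z \<in> unit_disk" for m z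
  proof -
    note n1 = norm_one_minus_square_le[OF b]
    have n2: "cmod (of_nat m + 1) = real m + 1"
      by (metis norm_of_nat of_nat_Suc add.commute)
    have "cmod z ^ m \<le> 1" "cmod (f z) \<le> \<bar>B\<bar>"
      using B[OF z] z by (auto intro: power_le_one)
    then have n3: "cmod (f z) * cmod z ^ m \<le> \<bar>B\<bar> * 1"
      by (intro mult_mono) auto
    have "cmod (h m z)
        = cmod (1 - (complex_of_real (cmod b))\<^sup>2) * ((real m + 1) * cmod b ^ m * (cmod (f z) * cmod z ^ m))"
      unfolding h_def norm_mult n2 norm_power complex_mod_cnj by simp
    also have "\<dots> \<le> 1 * ((real m + 1) * cmod b ^ m * (\<bar>B\<bar> * 1))"
      by (intro mult_mono[OF n1] mult_left_mono[OF n3]) auto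
    finally have "cmod (h m z) \<le> 1 * ((real m + 1) * cmod b ^ m * (\<bar>B\<bar> * 1))" .
    then show ?thesis by (simp add: mult_ac)
  qed
  have hint: "integrable disk_area (h m)" for m
    by (rule disk.integrable_const_bound[OF AE_I2]) (use hb in auto)
  have sm: "summable (\<lambda>m. \<bar>B\<bar> * ((real m + 1) * cmod b ^ m))"
    using b1 by (intro summable_mult summable_linear_power) simp
  have "(\<lambda>m. integral\<^sup>L disk_area (h m)) sums (LINT z|disk_area. (\<Sum>m. h m z))"
  proof (rule sums_integral[OF hint])
    show "AE z in disk_area. summable (\<lambda>m. norm (h m z))"
      using hb by (intro AE_I2) (auto intro!: summable_comparison_test'[OF sm])
    have "(LINT z|disk_area. norm (h m z)) \<le> \<bar>B\<bar> * ((real m + 1) * cmod b ^ m)" for m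
    proof -
      have "(LINT z|disk_area. norm (h m z)) \<le> (LINT z|disk_area. \<bar>B\<bar> * ((real m + 1) * cmod b ^ m))"
        using hb hint by (intro integral_mono) auto
      then show ?thesis by (simp add: measure_def emeasure_disk_area)
    qed
    then show "summable (\<lambda>m. LINT z|disk_area. norm (h m z))"
      by (auto intro!: summable_comparison_test'[OF sm])
  qed
  moreover have "integral\<^sup>L disk_area (h m)
      = (1 - (cmod b)\<^sup>2) * ((of_nat m + 1) * b ^ m * bergman_inner f (\<lambda>z. z ^ m))" for m
    unfolding h_def bergman_inner_def by simp
  moreover have "(LINT z|disk_area. (\<Sum>m. h m z)) = bergman_inner f (bergman_kernel b)"
    unfolding bergman_inner_def
  proof (rule Bochner_Integration.integral_cong[OF refl])
    fix z assume "z \<in> space disk_area"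
    then have "cmod (cnj b * z) < 1" using norm_cnj_mult_less_1[OF b] by simp
    then have "cmod (b * cnj z) < 1" by (simp add: norm_mult)
    \<comment> \<open>The differentiated geometric series at \<open>b * cnj z\<close> sums the terms
      to \<open>f z\<close> times the conjugated kernel.\<close>
    from sums_mult[OF geometric_deriv_sums[OF this], of "(1 - (cmod b)\<^sup>2) * f z"]
    have "(\<lambda>m. h m z) sums ((1 - (cmod b)\<^sup>2) * f z * (1 / (1 - b * cnj z)\<^sup>2))"
      by (simp add: h_def power_mult_distrib mult_ac add.commute)
    then show "(\<Sum>m. h m z) = f z * cnj (bergman_kernel b z)"
      by (simp add: sums_iff bergman_kernel_def mult_ac)
  qed
  ultimately show ?thesis by simp
qed

text \<open>The reproducing property for monomials: orthogonality leaves only the term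
  \<open>m = n\<close> of the kernel series, and its factor \<open>n + 1\<close> cancels the squared
  norm \<open>1 / (n + 1)\<close> of the monomial.\<close>

lemma bergman_inner_monomial_kernel:
  fixes b :: complex
  assumes b: "b \<in> unit_disk"
  shows "bergman_inner (\<lambda>z. z ^ n) (bergman_kernel b) = (1 - (cmod b)\<^sup>2) * b ^ n"
proof -
  have "(\<lambda>m. (1 - (cmod b)\<^sup>2) * ((of_nat m + 1) * b ^ m * bergman_inner (\<lambda>z. z ^ n) (\<lambda>z. z ^ m)))
      sums bergman_inner (\<lambda>z. z ^ n) (bergman_kernel b)"
    by (rule bergman_inner_kernel_sums[OF _ _ b, where B = 1])
       (auto intro!: borel_measurable_disk_area simp: norm_power power_le_one)
  moreover have "(of_nat n + 1 :: complex) \<noteq> 0"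
    by (metis of_nat_neq_0 of_nat_Suc add.commute)
  then have "(\<lambda>m. (1 - (cmod b)\<^sup>2) * ((of_nat m + 1) * b ^ m * bergman_inner (\<lambda>z. z ^ n) (\<lambda>z. z ^ m)))
      = (\<lambda>m. if m = n then (1 - (cmod b)\<^sup>2) * b ^ m else 0)"
    by (auto simp: fun_eq_iff bergman_inner_monomials)
  ultimately show ?thesis
    using sums_single[of n "\<lambda>m. (1 - (cmod b)\<^sup>2) * b ^ m"] sums_unique2 by fastforce
qed

lemma bergman_inner_kernel_monomial:
  fixes a :: complex
  shows "a \<in> unit_disk \<Longrightarrow> bergman_inner (bergman_kernel a) (\<lambda>z. z ^ n) = (1 - (cmod a)\<^sup>2) * cnj a ^ n"
  by (subst bergman_inner_cnj) (simp add: bergman_inner_monomial_kernel)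

text \<open>Inserting the values on monomials into the kernel series at \<open>b\<close> leaves the
  differentiated geometric series at \<open>cnj a * b\<close>.\<close>

lemma bergman_inner_kernels:
  assumes a: "a \<in> unit_disk" and b: "b \<in> unit_disk"
  shows "bergman_inner (bergman_kernel a) (bergman_kernel b)
    = (1 - (cmod a)\<^sup>2) * (1 - (cmod b)\<^sup>2) / (1 - cnj a * b)\<^sup>2"
proof -
  have "(\<lambda>m. (1 - (cmod b)\<^sup>2) * ((of_nat m + 1) * b ^ m * bergman_inner (bergman_kernel a) (\<lambda>z. z ^ m)))
      sums bergman_inner (bergman_kernel a) (bergman_kernel b)"
    by (rule bergman_inner_kernel_sums[OF bergman_kernel_measurable[OF a] norm_bergman_kernel_le[OF a] b])
  moreover have "(\<lambda>m. (1 - (cmod b)\<^sup>2) * ((of_nat m + 1) * b ^ m * bergman_inner (bergman_kernel a) (\<lambda>z. z ^ m)))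
      sums ((1 - (cmod a)\<^sup>2) * (1 - (cmod b)\<^sup>2) * (1 / (1 - cnj a * b)\<^sup>2))"
    using sums_mult[OF geometric_deriv_sums[OF norm_cnj_mult_less_1[OF a b]],
        of "(1 - (cmod a)\<^sup>2) * (1 - (cmod b)\<^sup>2)"]
    by (simp add: bergman_inner_kernel_monomial[OF a] power_mult_distrib mult_ac add.commute)
  ultimately show ?thesis
    using sums_unique2 by fastforce
qed

text \<open>Here \<open>h\<close> stands for the image of \<open>bergman_kernel a\<close>. The
  \<open>n\<close>-th term receives \<open>cnj a ^ n\<close> from the kernel at \<open>a\<close> and
  \<open>b ^ n\<close> from the kernel at \<open>b\<close>, so apart from the normalizing factors
  only \<open>cnj a * b\<close> matters.\<close>

lemma bergman_inner_diagonal_operator: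
  assumes a: "a \<in> unit_disk" and b: "b \<in> unit_disk"
    and T: "bergman_sums
        (\<lambda>n z. c n * (of_nat n + 1) * bergman_inner (bergman_kernel a) (\<lambda>w. w ^ n) * z ^ n) h"
  shows "(\<lambda>n. (1 - (cmod a)\<^sup>2) * (1 - (cmod b)\<^sup>2) * (c n * (of_nat n + 1) * (cnj a * b) ^ n))
    sums bergman_inner h (bergman_kernel b)"
proof -
  have "bergman_inner (\<lambda>z. d * z ^ n) (bergman_kernel b) = d * ((1 - (cmod b)\<^sup>2) * b ^ n)" for d n
    unfolding bergman_inner_monomial_kernel[OF b, symmetric] bergman_inner_def
    by (simp add: mult.assoc)
  then have "bergman_inner (\<lambda>z. c n * (of_nat n + 1) * bergman_inner (bergman_kernel a) (\<lambda>w. w ^ n) * z ^ n)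
        (bergman_kernel b)
      = (1 - (cmod a)\<^sup>2) * (1 - (cmod b)\<^sup>2) * (c n * (of_nat n + 1) * (cnj a * b) ^ n)" for n
    by (simp add: bergman_inner_kernel_monomial[OF a] power_mult_distrib)
  with bergman_sums_inner[OF T bergman_kernel_measurable[OF b] norm_bergman_kernel_le[OF b]]
  show ?thesis by simp
qed

section \<open>The values of \<open>cnj a * b\<close> that occur\<close>

text \<open>\<open>w\<close> stands for \<open>cnj a * b\<close>; the last condition is the AM-GM inequality
  \<open>2 * cmod a * cmod b \<le> (cmod a)\<^sup>2 + (cmod b)\<^sup>2\<close>.\<close>

definition kernel_products :: "real \<Rightarrow> real set" where
  "kernel_products q = {w. \<bar>w\<bar> < 1 \<and> sqrt q * (1 - w) \<le> 1 - \<bar>w\<bar>}"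

text \<open>Read as \<open>\<bar>w\<bar> < 1\<close> and
  \<open>sqrt q * (1 - w) + \<bar>w\<bar> \<le> 1\<close>, both conditions bound a convex function
  of \<open>w\<close> by a constant.\<close>

lemma convex_kernel_products:
  "convex (kernel_products q)"
proof -
  have "u * x + v * y \<in> kernel_products q"
    if x: "x \<in> kernel_products q" and y: "y \<in> kernel_products q" and uv: "0 \<le> u" "0 \<le> v" "u + v = 1"
    for x y u v
  proof -
    have tri: "\<bar>u * x + v * y\<bar> \<le> u * \<bar>x\<bar> + v * \<bar>y\<bar>"
      using uv abs_triangle_ineq[of "u * x" "v * y"] by (simp add: abs_mult)
    have "u * \<bar>x\<bar> + v * \<bar>y\<bar> < 1"
      using x y uv by (intro convex_bound_lt) (auto simp: kernel_products_def)
    moreover have "u * (sqrt q * (1 - x)) + v * (sqrt q * (1 - y)) \<le> u * (1 - \<bar>x\<bar>) + v * (1 - \<bar>y\<bar>)"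
      using x y uv by (intro add_mono mult_left_mono) (auto simp: kernel_products_def)
    moreover have "u * (sqrt q * (1 - x)) + v * (sqrt q * (1 - y)) = sqrt q * ((u + v) - (u * x + v * y))"
      by (simp add: algebra_simps)
    moreover have "u * (1 - \<bar>x\<bar>) + v * (1 - \<bar>y\<bar>) = (u + v) - (u * \<bar>x\<bar> + v * \<bar>y\<bar>)"
      by (simp add: algebra_simps)
    ultimately show ?thesis
      using tri uv(3) by (simp add: kernel_products_def)
  qed
  then show ?thesis by (simp add: convex_def)
qed

lemma kernel_product_in_kernel_products:
  fixes q :: real
  assumes q: "0 < q" and a: "cmod a < 1" and b: "cmod b < 1"
    and eq: "(1 - (cmod a)\<^sup>2) * (1 - (cmod b)\<^sup>2) / (1 - cnj a * b)\<^sup>2 = complex_of_real q"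
  obtains w where "w \<in> kernel_products q" "cnj a * b = of_real w"
    "(1 - (cmod a)\<^sup>2) * (1 - (cmod b)\<^sup>2) = q * (1 - w)\<^sup>2"
proof -
  define W where "W = cnj a * b"
  have W1: "cmod W < 1"
    using norm_cnj_mult_less_1[of a b] a b by (simp add: W_def)
  then have nz: "1 - W \<noteq> 0" by auto
  define p where "p = (1 - (cmod a)\<^sup>2) * (1 - (cmod b)\<^sup>2)"
  have "0 < p"
    using a b by (simp add: p_def abs_square_less_1)
  have "of_real p / (1 - W)\<^sup>2 = complex_of_real q"
    using eq by (simp add: W_def p_def)
  then have sq: "(1 - W)\<^sup>2 = complex_of_real (p / q)"
    using nz q by (simp add: divide_eq_eq eq_divide_eq mult.commute)
  \<comment> \<open>The imaginary part of the real number \<open>(1 - W)\<^sup>2\<close> is twice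
    the product of the real and imaginary parts of \<open>1 - W\<close>; the real part being
    positive, the imaginary part vanishes.\<close>
  have "0 < Re (1 - W)"
    using W1 complex_Re_le_cmod[of W] by simp
  moreover have "2 * Re (1 - W) * Im (1 - W) = 0"
    using sq by (metis Im_complex_of_real Im_power2)
  ultimately have "Im (1 - W) = 0" by simp
  then have W: "W = of_real (Re W)" by (simp add: complex_eq_iff)
  define w where "w = Re W"
  have "complex_of_real ((1 - w)\<^sup>2) = complex_of_real (p / q)"
    using sq W by (simp add: w_def)
  then have "(1 - w)\<^sup>2 = p / q"
    by (simp only: of_real_eq_iff)
  then have pq: "p = q * (1 - w)\<^sup>2" using q by simp
  have w1: "\<bar>w\<bar> < 1" using W1 W by (metis norm_of_real w_def)
  have absw: "\<bar>w\<bar> = cmod a * cmod b"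
    using W by (metis W_def complex_mod_cnj norm_mult norm_of_real w_def)
  \<comment> \<open>This is the identity \<open>(1 - x\<^sup>2) * (1 - y\<^sup>2) = (1 - x *
    y)\<^sup>2 - (x - y)\<^sup>2\<close> for \<open>x = cmod a\<close> and
    \<open>y = cmod b\<close>.\<close>
  have "q * (1 - w)\<^sup>2 \<le> (1 - \<bar>w\<bar>)\<^sup>2"
    using zero_le_power2[of "cmod a - cmod b"]
    unfolding pq[symmetric] p_def absw by (simp add: power2_eq_square algebra_simps)
  then have "(sqrt q * (1 - w))\<^sup>2 \<le> (1 - \<bar>w\<bar>)\<^sup>2"
    using q by (simp add: power_mult_distrib)
  then have "sqrt q * (1 - w) \<le> 1 - \<bar>w\<bar>"
    by (rule power2_le_imp_le) (use w1 in simp)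
  with w1 have "w \<in> kernel_products q" by (simp add: kernel_products_def)
  moreover have "cnj a * b = of_real w" using W unfolding W_def w_def .
  ultimately show thesis using pq unfolding p_def by (rule that)
qed

text \<open>The squares of the moduli are the roots of a quadratic whose discriminant is nonnegative by the
  last condition in the definition.\<close>

lemma kernel_products_realized:
  fixes q :: real
  assumes q: "0 < q" and w: "w \<in> kernel_products q"
  obtains a b where "a \<in> unit_disk" "b \<in> unit_disk" "cnj a * b = of_real w"
    "(1 - (cmod a)\<^sup>2) * (1 - (cmod b)\<^sup>2) = q * (1 - w)\<^sup>2"
proof -
  \<comment> \<open>With \<open>x * y = w\<^sup>2\<close>, expanding
    \<open>(1 - x) * (1 - y) = q * (1 - w)\<^sup>2\<close> forces \<open>x + y = s\<close>.\<close>
  define s where "s = 1 + w\<^sup>2 - q * (1 - w)\<^sup>2"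
  have w1: "\<bar>w\<bar> < 1" and "sqrt q * (1 - w) \<le> 1 - \<bar>w\<bar>"
    using w by (auto simp: kernel_products_def)
  then have "(sqrt q * (1 - w))\<^sup>2 \<le> (1 - \<bar>w\<bar>)\<^sup>2"
    using q by (intro power_mono) auto
  then have s: "2 * \<bar>w\<bar> \<le> s"
    using q by (simp add: power_mult_distrib s_def power2_diff)
  define d where "d = sqrt (s\<^sup>2 - 4 * w\<^sup>2)"
  have "(2 * \<bar>w\<bar>)\<^sup>2 \<le> s\<^sup>2"
    using s by (intro power_mono) auto
  then have d2: "d\<^sup>2 = s\<^sup>2 - 4 * w\<^sup>2" and "0 \<le> d"
    by (simp_all add: d_def power_mult_distrib)
  have "d \<le> s"
  proof (rule power2_le_imp_le)
    show "d\<^sup>2 \<le> s\<^sup>2" unfolding d2 by simp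
    show "0 \<le> s" using s abs_ge_zero[of w] by linarith
  qed
  define x y where "x = (s + d) / 2" and "y = (s - d) / 2"
  have xy: "x * y = w\<^sup>2" "x + y = s" "0 \<le> y" "y \<le> x"
    using d2 \<open>d \<le> s\<close> \<open>0 \<le> d\<close> by (auto simp: x_def y_def field_simps power2_eq_square)
  have eq: "(1 - x) * (1 - y) = q * (1 - w)\<^sup>2"
  proof -
    have "(1 - x) * (1 - y) = 1 - (x + y) + x * y" by (simp add: algebra_simps)
    then show ?thesis using xy by (simp add: s_def)
  qed
  then have pos: "0 < (1 - x) * (1 - y)"
    using q w1 by simp
  \<comment> \<open>Positivity of the product only says that \<open>1 - x\<close> and
    \<open>1 - y\<close> have the same sign. If the smaller root \<open>y\<close> were at least 1,
    then \<open>x * y = w\<^sup>2\<close> would be too.\<close>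
  have "y < 1"
  proof (rule ccontr)
    assume "\<not> y < 1"
    then have "1 * 1 \<le> x * y" using xy by (intro mult_mono) auto
    moreover have "w\<^sup>2 < 1" using w1 by (simp add: abs_square_less_1)
    ultimately show False using xy by simp
  qed
  then have "x < 1" using pos by (simp add: zero_less_mult_iff)
  have xyw: "sqrt x * sqrt y = \<bar>w\<bar>"
    using xy by (simp flip: real_sqrt_mult)
  have "0 \<le> x" using xy by simp
  \<comment> \<open>Both points are taken real: \<open>a = sqrt x\<close>, while \<open>b\<close> is
    \<open>sqrt y\<close> with the sign of \<open>w\<close>.\<close>
  show thesis
  proof (rule that)
    show "complex_of_real (sqrt x) \<in> unit_disk" using \<open>x < 1\<close> \<open>0 \<le> x\<close> by simp
    show "complex_of_real (if 0 \<le> w then sqrt y else - sqrt y) \<in> unit_disk"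
      using \<open>y < 1\<close> \<open>0 \<le> y\<close> by simp
    have "sqrt x * (if 0 \<le> w then sqrt y else - sqrt y) = w" using xyw by auto
    then show "cnj (complex_of_real (sqrt x)) * complex_of_real (if 0 \<le> w then sqrt y else - sqrt y)
        = complex_of_real w"
      by (simp only: complex_cnj_complex_of_real of_real_mult[symmetric])
    show "(1 - (cmod (complex_of_real (sqrt x)))\<^sup>2)
        * (1 - (cmod (complex_of_real (if 0 \<le> w then sqrt y else - sqrt y)))\<^sup>2) = q * (1 - w)\<^sup>2"
      using eq \<open>0 \<le> x\<close> \<open>0 \<le> y\<close> by (simp add: norm_of_real)
  qed
qed

section \<open>The range as a continuous image of an interval\<close>

lemma summable_weighted_powers:
  fixes \<alpha> :: "nat \<Rightarrow> real" and w :: real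
  assumes "bounded (range \<alpha>)" and "\<bar>w\<bar> < 1"
  shows "summable (\<lambda>n. \<alpha> n * (real n + 1) * w ^ n)"
proof -
  obtain M where M: "\<And>n. \<bar>\<alpha> n\<bar> \<le> M"
    using assms(1) by (auto simp: bounded_iff)
  have "summable (\<lambda>n. M * ((real n + 1) * \<bar>w\<bar> ^ n))"
    using assms(2) by (intro summable_mult summable_linear_power) simp
  then show ?thesis
  proof (rule summable_comparison_test')
    show "norm (\<alpha> n * (real n + 1) * w ^ n) \<le> M * ((real n + 1) * \<bar>w\<bar> ^ n)" for n
      using mult_right_mono[OF M[of n], of "(real n + 1) * \<bar>w\<bar> ^ n"]
      by (simp add: abs_mult power_abs mult.assoc)
  qed
qed

theorem theorem3p6:
  fixes q :: real and \<alpha> :: "nat \<Rightarrow> real"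
    and T :: "(complex \<Rightarrow> complex) \<Rightarrow> (complex \<Rightarrow> complex)"
  assumes "0 < q" and "q \<le> 1"
    and "bounded (range \<alpha>)"
    and "\<And>f. f \<in> bergman_space \<Longrightarrow>
      bergman_sums
        (\<lambda>n z. of_real (\<alpha> n) * (of_nat n + 1) * bergman_inner f (\<lambda>w. w ^ n) * z ^ n) (T f)"
  shows "convex (q_berezin_range (of_real q) T)"
proof -
  \<comment> \<open>The factor \<open>q * (1 - w)\<^sup>2\<close> is the product of the two kernel
    normalizations, rewritten by the constraint on the inner product. The series converges for
    \<open>\<bar>w\<bar> < 1\<close>, hence on \<open>kernel_products q\<close>.\<close>
  define F where "F w = q * (1 - w)\<^sup>2 * (\<Sum>n. \<alpha> n * (real n + 1) * w ^ n)" for w :: real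
  have range_value: "bergman_inner (T (bergman_kernel a)) (bergman_kernel b) = of_real (F w)"
    if a: "a \<in> unit_disk" and b: "b \<in> unit_disk" and w: "cnj a * b = of_real w" "\<bar>w\<bar> < 1"
      and p: "(1 - (cmod a)\<^sup>2) * (1 - (cmod b)\<^sup>2) = q * (1 - w)\<^sup>2" for a b w
  proof -
    have p': "(1 - (complex_of_real (cmod a))\<^sup>2) * (1 - (complex_of_real (cmod b))\<^sup>2)
        = complex_of_real (q * (1 - w)\<^sup>2)"
      by (simp flip: p)
    have "(\<lambda>n. (q * (1 - w)\<^sup>2) * (\<alpha> n * (real n + 1) * w ^ n)) sums F w"
      unfolding F_def by (intro sums_mult summable_sums summable_weighted_powers assms w)
    then have "(\<lambda>n. complex_of_real ((q * (1 - w)\<^sup>2) * (\<alpha> n * (real n + 1) * w ^ n))) sums of_real (F w)"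
      by (rule sums_of_real)
    moreover have "(\<lambda>n. complex_of_real ((q * (1 - w)\<^sup>2) * (\<alpha> n * (real n + 1) * w ^ n)))
        sums bergman_inner (T (bergman_kernel a)) (bergman_kernel b)"
      using bergman_inner_diagonal_operator[OF a b assms(4)[OF bergman_kernel_in_space[OF a]]]
      by (simp add: w p')
    ultimately show ?thesis using sums_unique2 by blast
  qed
  have "q_berezin_range (of_real q) T = of_real ` F ` kernel_products q"
  proof (intro equalityI subsetI)
    fix v assume "v \<in> q_berezin_range (of_real q) T"
    then obtain a b where v: "v = bergman_inner (T (bergman_kernel a)) (bergman_kernel b)"
      and a: "a \<in> unit_disk" and b: "b \<in> unit_disk"
      and "bergman_inner (bergman_kernel a) (bergman_kernel b) = of_real q"
      by (auto simp: q_berezin_range_def)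
    then have "(1 - (cmod a)\<^sup>2) * (1 - (cmod b)\<^sup>2) / (1 - cnj a * b)\<^sup>2 = complex_of_real q"
      by (simp add: bergman_inner_kernels)
    with a b obtain w where w: "w \<in> kernel_products q" "cnj a * b = of_real w"
        "(1 - (cmod a)\<^sup>2) * (1 - (cmod b)\<^sup>2) = q * (1 - w)\<^sup>2"
      using kernel_product_in_kernel_products[OF \<open>0 < q\<close>, of a b] by auto
    then have "v = of_real (F w)"
      unfolding v by (intro range_value a b) (auto simp: kernel_products_def)
    with w(1) show "v \<in> of_real ` F ` kernel_products q" by blast
  next
    fix v assume "v \<in> complex_of_real ` F ` kernel_products q"
    then obtain w where v: "v = of_real (F w)" and w: "w \<in> kernel_products q" by blast
    then have w1: "\<bar>w\<bar> < 1" by (simp add: kernel_products_def)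
    obtain a b where a: "a \<in> unit_disk" and b: "b \<in> unit_disk" and ab: "cnj a * b = of_real w"
      and p: "(1 - (cmod a)\<^sup>2) * (1 - (cmod b)\<^sup>2) = q * (1 - w)\<^sup>2"
      using kernel_products_realized[OF \<open>0 < q\<close> w] .
    have "bergman_inner (bergman_kernel a) (bergman_kernel b)
        = of_real ((1 - (cmod a)\<^sup>2) * (1 - (cmod b)\<^sup>2)) / of_real ((1 - w)\<^sup>2)"
      by (simp add: bergman_inner_kernels[OF a b] ab)
    also have "\<dots> = of_real q"
      unfolding p of_real_divide[symmetric] using w1 by simp
    finally show "v \<in> q_berezin_range (of_real q) T"
      unfolding v range_value[OF a b ab w1 p, symmetric] q_berezin_range_def using a b by blast
  qed
  moreover have "convex (F ` kernel_products q)"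
  proof -
    have "isCont F w" if "w \<in> kernel_products q" for w
    proof -
      have "\<bar>w\<bar> < 1" using that by (simp add: kernel_products_def)
      \<comment> \<open>A power series is continuous at \<open>w\<close> if it converges at some
        \<open>K\<close> farther from 0; \<open>K < 1\<close> ensures this because
        \<open>\<alpha>\<close> is bounded.\<close>
      then obtain K where K: "\<bar>w\<bar> < K" "K < 1" using dense by blast
      have "isCont (\<lambda>x. \<Sum>n. \<alpha> n * (real n + 1) * x ^ n) w"
        by (rule isCont_powser[of _ K]) (use K assms(3) in \<open>auto intro: summable_weighted_powers\<close>)
      then show ?thesis
        unfolding F_def[abs_def] by (intro continuous_intros)
    qed
    then have "continuous_on (kernel_products q) F"
      by (simp add: continuous_at_imp_continuous_on)
    \<comment> \<open>Continuous maps preserve connectedness rather than convexity, but on the real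
      line the two notions agree.\<close>
    then have "connected (F ` kernel_products q)"
      by (intro connected_continuous_image convex_connected convex_kernel_products)
    then show ?thesis
      by (simp add: is_interval_connected_1 flip: is_interval_convex_1)
  qed
  \<comment> \<open>\<open>of_real\<close> is real-linear, so the convex set of reals stays convex
    in the complex plane.\<close>
  ultimately show ?thesis
    by (simp add: convex_linear_image bounded_linear.linear[OF bounded_linear_of_real])
qed

end
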